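(* For complex parameters $A=(A_0,A_1,A_2,A_3)$, the operator $$R(A):=\mathrm{Ad}\left(x^{A_0+A_2}(x-1)^{A_1+A_2}\right)Q(A)$$ has the expression $R(A)=x^2(x-1)^2\partial^3+r_1(x)\partial^2+r_2(x)\partial+r_3(x)$, where \begin{align*} r_1&=(1-x)x(3A_0x-3A_0+3A_1x+2A_2x-A_2-6x+3),\\ r_2&=3A_0^2x^2-5A_0^2x+2A_0^2+6A_0A_1x^2-6A_0A_1x+4A_0A_2x^2-6A_0A_2x+2A_0A_2\\ &\quad-9A_0x^2+12A_0x-3A_0+3A_1^2x^2-A_1^2x+4A_1A_2x^2-2A_1A_2x-9A_1x^2+6A_1x\\ &\quad+A_2^2x^2-A_2^2x-6A_2x^2+6A_2x-A_2-A_3^2x^2+A_3^2x+7x^2-7x+1,\\ r_3&=-\tfrac12(2A_0x-2A_0+2A_1x-2x+1)(A_0+A_1+A_2-A_3-1)(A_0+A_1+A_2+A_3-1). \end{align*}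
   Context: Here $\partial=d/dx$, and for a nonzero function $f$ the addition is $\mathrm{Ad}(f)P=f\circ P\circ f^{-1}$. The operator $Q(A)$ is $$Q(A)=x^2(x-1)^2\partial^3+q_1(x)\partial^2+q_2(x)\partial+q_3(x),$$ \begin{align*} q_1&=(2A_2+3)(x-1)x(2x-1),\\ q_2&=A_0^2x-A_0^2-A_1^2x+5A_2^2x^2-5A_2^2x+A_2^2+12A_2x^2-12A_2x+2A_2-A_3^2x^2+A_3^2x+7x^2-7x+1,\\ q_3&=\tfrac12(2A_2+1)\left(A_0^2-A_1^2+2A_2^2x-A_2^2+4A_2x-2A_2-2A_3^2x+A_3^2+2x-1\right). \end{align*} *)

theory Defs
  imports "HOL-Complex_Analysis.Complex_Analysis"
begin

type_synonym operator = "(complex \<Rightarrow> complex) \<Rightarrow> (complex \<Rightarrow> complex)"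

definition mult_op :: "(complex \<Rightarrow> complex) \<Rightarrow> operator" where
  "mult_op f = (\<lambda>u x. f x * u x)"

definition Ad :: "(complex \<Rightarrow> complex) \<Rightarrow> operator \<Rightarrow> operator" where
  "Ad f P = mult_op f \<circ> P \<circ> mult_op (\<lambda>x. inverse (f x))"

text \<open>Third-order operators, coefficients listed from the highest order down. Values of
  \<open>diff_op3 p0 p1 p2 p3 u\<close> on an open set depend only on \<open>u\<close> on that set.\<close>

definition diff_op3 ::
  "(complex \<Rightarrow> complex) \<Rightarrow> (complex \<Rightarrow> complex) \<Rightarrow> (complex \<Rightarrow> complex) \<Rightarrow> (complex \<Rightarrow> complex) \<Rightarrow> operator" where
  "diff_op3 p0 p1 p2 p3 =
     (\<lambda>u x. p0 x * (deriv ^^ 3) u x + p1 x * (deriv ^^ 2) u x + p2 x * deriv u x + p3 x * u x)"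

text \<open>Total functions on \<^typ>\<open>complex\<close> carry irrelevant values outside the domain, so two
  operators are identified when they agree on \<open>S\<close> on all functions holomorphic on \<open>S\<close>.\<close>

definition op_eq_on :: "complex set \<Rightarrow> operator \<Rightarrow> operator \<Rightarrow> bool" where
  "op_eq_on S P R \<longleftrightarrow> (\<forall>u. u holomorphic_on S \<longrightarrow> (\<forall>x\<in>S. P u x = R u x))"

text \<open>\<open>f\<close> is a holomorphic branch on \<open>S\<close> of the multivalued function \<open>(x - c)\<^sup>a\<close>; the existence
  of the logarithm \<open>L\<close> of \<open>x - c\<close> forces \<open>c \<notin> S\<close>.\<close>

definition power_branch_on :: "complex set \<Rightarrow> complex \<Rightarrow> complex \<Rightarrow> (complex \<Rightarrow> complex) \<Rightarrow> bool" where
  "power_branch_on S c a f \<longleftrightarrow>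
     (\<exists>L. L holomorphic_on S \<and> (\<forall>x\<in>S. exp (L x) = x - c \<and> f x = exp (a * L x)))"

definition q1 :: "complex \<Rightarrow> complex \<Rightarrow> complex \<Rightarrow> complex \<Rightarrow> complex \<Rightarrow> complex" where
  "q1 A0 A1 A2 A3 x = (2*A2 + 3) * (x - 1) * x * (2*x - 1)"

definition q2 :: "complex \<Rightarrow> complex \<Rightarrow> complex \<Rightarrow> complex \<Rightarrow> complex \<Rightarrow> complex" where
  "q2 A0 A1 A2 A3 x =
     A0^2*x - A0^2 - A1^2*x + 5*A2^2*x^2 - 5*A2^2*x + A2^2 + 12*A2*x^2 - 12*A2*x + 2*A2
     - A3^2*x^2 + A3^2*x + 7*x^2 - 7*x + 1"

definition q3 :: "complex \<Rightarrow> complex \<Rightarrow> complex \<Rightarrow> complex \<Rightarrow> complex \<Rightarrow> complex" where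
  "q3 A0 A1 A2 A3 x =
     1/2 * (2*A2 + 1) *
       (A0^2 - A1^2 + 2*A2^2*x - A2^2 + 4*A2*x - 2*A2 - 2*A3^2*x + A3^2 + 2*x - 1)"

definition Q_op :: "complex \<Rightarrow> complex \<Rightarrow> complex \<Rightarrow> complex \<Rightarrow> operator" where
  "Q_op A0 A1 A2 A3 =
     diff_op3 (\<lambda>x. x^2 * (x - 1)^2) (q1 A0 A1 A2 A3) (q2 A0 A1 A2 A3) (q3 A0 A1 A2 A3)"

definition r1 :: "complex \<Rightarrow> complex \<Rightarrow> complex \<Rightarrow> complex \<Rightarrow> complex \<Rightarrow> complex" where
  "r1 A0 A1 A2 A3 x =
     (1 - x) * x * (3*A0*x - 3*A0 + 3*A1*x + 2*A2*x - A2 - 6*x + 3)"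

definition r2 :: "complex \<Rightarrow> complex \<Rightarrow> complex \<Rightarrow> complex \<Rightarrow> complex \<Rightarrow> complex" where
  "r2 A0 A1 A2 A3 x =
     3*A0^2*x^2 - 5*A0^2*x + 2*A0^2 + 6*A0*A1*x^2 - 6*A0*A1*x + 4*A0*A2*x^2 - 6*A0*A2*x + 2*A0*A2
     - 9*A0*x^2 + 12*A0*x - 3*A0 + 3*A1^2*x^2 - A1^2*x + 4*A1*A2*x^2 - 2*A1*A2*x - 9*A1*x^2 + 6*A1*x
     + A2^2*x^2 - A2^2*x - 6*A2*x^2 + 6*A2*x - A2 - A3^2*x^2 + A3^2*x + 7*x^2 - 7*x + 1"

definition r3 :: "complex \<Rightarrow> complex \<Rightarrow> complex \<Rightarrow> complex \<Rightarrow> complex \<Rightarrow> complex" where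
  "r3 A0 A1 A2 A3 x =
     - (1/2) * (2*A0*x - 2*A0 + 2*A1*x - 2*x + 1) * (A0 + A1 + A2 - A3 - 1) * (A0 + A1 + A2 + A3 - 1)"

text \<open>\<open>g\<close> and \<open>h\<close> stand for branches of \<open>x\<^sup>a\<close>, \<open>a = A0 + A2\<close>, and \<open>(x - 1)\<^sup>b\<close>, \<open>b = A1 + A2\<close>.\<close>

definition R_op ::
  "(complex \<Rightarrow> complex) \<Rightarrow> (complex \<Rightarrow> complex) \<Rightarrow> complex \<Rightarrow> complex \<Rightarrow> complex \<Rightarrow> complex \<Rightarrow> operator" where
  "R_op g h A0 A1 A2 A3 = Ad (\<lambda>x. g x * h x) (Q_op A0 A1 A2 A3)"

end

theory Submission
  imports Defs
begin

text \<open>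
  Writing \<open>w = 1/(g h)\<close>, the logarithmic derivative \<open>w'/w = - a/x - b/(x - 1)\<close>, with
  \<open>a = A0 + A2\<close> and \<open>b = A1 + A2\<close>, is rational, so conjugating \<open>Q(A)\<close> amounts to replacing
  \<open>\<partial>\<close> by \<open>\<partial> + w'/w\<close>. Comparing coefficients leaves three rational identities.
\<close>

text \<open>Differentiating \<open>exp (L x) = x - c\<close> in two ways gives
  \<open>L' = 1/(x - c)\<close>, so \<open>inverse (f x) = exp (- (a * L x))\<close> has logarithmic
  derivative \<open>- a / (x - c)\<close>. The inverse is treated because it is the factor that
  \<open>Ad\<close> places under the derivatives.\<close>

lemma power_branch_on_props:
  assumes "open S" and "power_branch_on S c a f" and "x \<in> S"
  shows "x \<noteq> c" and "f x \<noteq> 0"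
    and "((\<lambda>x. inverse (f x)) has_field_derivative - a / (x - c) * inverse (f x)) (at x)"
proof -
  obtain L where hol: "L holomorphic_on S"
    and L: "\<And>x. x \<in> S \<Longrightarrow> exp (L x) = x - c" "\<And>x. x \<in> S \<Longrightarrow> f x = exp (a * L x)"
    using assms(2) unfolding power_branch_on_def by blast
  show "x \<noteq> c" "f x \<noteq> 0"
    using L[OF \<open>x \<in> S\<close>] by (metis exp_not_eq_zero diff_self) (simp add: L \<open>x \<in> S\<close>)
  have dL: "(L has_field_derivative deriv L x) (at x)"
    using holomorphic_derivI[OF hol assms(1,3)] .
  have "((\<lambda>x. exp (L x)) has_field_derivative exp (L x) * deriv L x) (at x)"
    by (rule DERIV_fun_exp[OF dL])
  moreover have "((\<lambda>x. exp (L x)) has_field_derivative 1) (at x)"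
    by (rule has_field_derivative_transform_within_open[OF _ assms(1,3), of "\<lambda>x. x - c"])
       (auto intro!: derivative_eq_intros simp: L)
  ultimately have "(x - c) * deriv L x = 1"
    using DERIV_unique L(1)[OF assms(3)] by fastforce
  then have L': "deriv L x = 1 / (x - c)"
    by (metis mult_zero_left nonzero_eq_divide_eq mult.commute zero_neq_one)
  have "((\<lambda>x. exp (- (a * L x))) has_field_derivative - a / (x - c) * exp (- (a * L x))) (at x)"
    by (rule derivative_eq_intros dL refl)+ (simp add: L')
  then have "((\<lambda>x. inverse (f x)) has_field_derivative - a / (x - c) * exp (- (a * L x))) (at x)"
    by (rule has_field_derivative_transform_within_open[OF _ assms(1,3)]) (simp add: L exp_minus)
  then show "((\<lambda>x. inverse (f x)) has_field_derivative - a / (x - c) * inverse (f x)) (at x)"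
    by (simp add: L assms(3) exp_minus)
qed

text \<open>Reduces an iterated derivative to checking a guessed chain \<open>G 0, ..., G n\<close>
  one derivative at a time. Openness of \<open>S\<close> lets agreement on \<open>S\<close> pass to
  derivatives at its points.\<close>

lemma higher_deriv_eqI:
  fixes G :: "nat \<Rightarrow> 'a \<Rightarrow> 'a::real_normed_field"
  assumes "open S"
    and "\<And>k x. k < n \<Longrightarrow> x \<in> S \<Longrightarrow> (G k has_field_derivative G (Suc k) x) (at x)"
    and "x \<in> S"
  shows "(deriv ^^ n) (G 0) x = G n x"
  using assms(2,3)
proof (induction n arbitrary: x)
  case (Suc n)
  have "((deriv ^^ n) (G 0) has_field_derivative G (Suc n) x) (at x)"
    by (rule has_field_derivative_transform_within_open[OF _ \<open>open S\<close> Suc.prems(2), of "G n"])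
       (use Suc in auto)
  then show ?case
    by (simp add: DERIV_imp_deriv)
qed simp

text \<open>Since \<open>w' = p w\<close>, differentiating \<open>w u\<close> amounts to applying
  \<open>D + p\<close> to \<open>u\<close>, with \<open>D\<close> the derivative, and multiplying by
  \<open>w\<close>. The right-hand sides are the expansions of \<open>D + p\<close>,
  \<open>(D + p)^2\<close> and \<open>(D + p)^3\<close>.\<close>

lemma higher_deriv_mult_log_deriv:
  assumes S: "open S" "x \<in> S" and u: "u holomorphic_on S"
    and w: "\<And>x. x \<in> S \<Longrightarrow> (w has_field_derivative p x * w x) (at x)"
    and p: "\<And>x. x \<in> S \<Longrightarrow> (p has_field_derivative p' x) (at x)"
    and p': "\<And>x. x \<in> S \<Longrightarrow> (p' has_field_derivative p'' x) (at x)"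
  shows "deriv (\<lambda>x. w x * u x) x = w x * (deriv u x + p x * u x)" (is ?th1)
    and "(deriv ^^ 2) (\<lambda>x. w x * u x) x =
      w x * ((deriv ^^ 2) u x + 2 * p x * deriv u x + (p' x + (p x)^2) * u x)" (is ?th2)
    and "(deriv ^^ 3) (\<lambda>x. w x * u x) x =
      w x * ((deriv ^^ 3) u x + 3 * p x * (deriv ^^ 2) u x + 3 * (p' x + (p x)^2) * deriv u x
        + (p'' x + 3 * p x * p' x + (p x)^3) * u x)" (is ?th3)
proof -
  \<comment> \<open>The list has entries 0 to 3 only, so the derivative step below is restricted to
    \<open>k < 3\<close>.\<close>
  define G where "G k = [\<lambda>x. w x * u x, \<lambda>x. w x * (deriv u x + p x * u x),
    \<lambda>x. w x * ((deriv ^^ 2) u x + 2 * p x * deriv u x + (p' x + (p x)^2) * u x),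
    \<lambda>x. w x * ((deriv ^^ 3) u x + 3 * p x * (deriv ^^ 2) u x + 3 * (p' x + (p x)^2) * deriv u x
        + (p'' x + 3 * p x * p' x + (p x)^3) * u x)] ! k" for k
  have u': "((deriv ^^ k) u has_field_derivative (deriv ^^ Suc k) u x) (at x)" if "x \<in> S" for k x
    using holomorphic_derivI[OF holomorphic_higher_deriv[OF u S(1)] S(1) that] by simp
  note u'' = u'[of _ 0, simplified] u'[of _ 1, simplified]
    u'[of _ 2, unfolded eval_nat_numeral, simplified]
  have G: "(G k has_field_derivative G (Suc k) x) (at x)" if "k < 3" "x \<in> S" for k x
  proof -
    consider "k = 0" | "k = 1" | "k = 2" using \<open>k < 3\<close> by linarith
    then show ?thesis
      by cases (auto simp: G_def eval_nat_numeral algebra_simps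
          intro!: derivative_eq_intros w p p' u'' \<open>x \<in> S\<close>)
  qed
  have "(deriv ^^ n) (G 0) x = G n x" if "n \<le> 3" for n
    by (rule higher_deriv_eqI[OF S(1) _ S(2)]) (use G that in auto)
  from this[of 1] this[of 2] this[of 3] show ?th1 ?th2 ?th3
    by (simp_all add: G_def eval_nat_numeral)
qed

text \<open>The left-hand sides are the coefficients of \<open>D^2\<close>, \<open>D\<close> and 1
  in \<open>Q(A)\<close> with \<open>D\<close> replaced by \<open>D + p\<close>. Here
  \<open>p\<close>, \<open>p'\<close> and \<open>p''\<close> are numbers, the values at one
  point.\<close>

lemma conjugated_coefficients:
  assumes "x \<noteq> 0" "x \<noteq> 1"
    and p: "p = - (A0 + A2) / x - (A1 + A2) / (x - 1)"
    and p': "p' = (A0 + A2) / x^2 + (A1 + A2) / (x - 1)^2"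
    and p'': "p'' = - 2 * (A0 + A2) / x^3 - 2 * (A1 + A2) / (x - 1)^3"
  shows "q1 A0 A1 A2 A3 x + 3 * (x^2 * (x - 1)^2) * p = r1 A0 A1 A2 A3 x" (is ?th1)
    and "q2 A0 A1 A2 A3 x + 2 * q1 A0 A1 A2 A3 x * p + 3 * (x^2 * (x - 1)^2) * (p' + p^2)
      = r2 A0 A1 A2 A3 x" (is ?th2)
    and "q3 A0 A1 A2 A3 x + q2 A0 A1 A2 A3 x * p + q1 A0 A1 A2 A3 x * (p' + p^2)
      + x^2 * (x - 1)^2 * (p'' + 3 * p * p' + p^3) = r3 A0 A1 A2 A3 x" (is ?th3)
proof -
  define a b where "a = A0 + A2" and "b = A1 + A2"
  \<comment> \<open>\<open>m\<^sub>k = x\<^sup>k (x - 1)\<^sup>k w\<^sup>(\<^sup>k\<^sup>) / w\<close> for \<open>w = x\<^sup>-\<^sup>a (x - 1)\<^sup>-\<^sup>b\<close>, computed by the Leibniz rule\<close>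
  define m1 m2 m3 where "m1 = - (a * (x - 1) + b * x)"
    and "m2 = a * (a + 1) * (x - 1)^2 + 2 * a * b * x * (x - 1) + b * (b + 1) * x^2"
    and "m3 = - (a * (a + 1) * (a + 2) * (x - 1)^3 + 3 * a * (a + 1) * b * x * (x - 1)^2
      + 3 * a * b * (b + 1) * x^2 * (x - 1) + b * (b + 1) * (b + 2) * x^3)"
  \<comment> \<open>Naming \<open>x - 1\<close> keeps it an atom, so that \<open>field_simps\<close>
    clears the denominators without expanding its powers.\<close>
  define y where "y = x - 1"
  have nz: "x \<noteq> 0" "y \<noteq> 0" using assms by (auto simp: y_def)
  have e: "p = - a / x - b / y" "p' = a / x^2 + b / y^2" "p'' = - 2 * a / x^3 - 2 * b / y^3"
    by (simp_all add: p p' p'' a_def b_def y_def)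
  have M1: "x * (x - 1) * p = m1"
    using nz unfolding m1_def e y_def[symmetric] by (simp add: field_simps)
  have M2: "x^2 * (x - 1)^2 * (p' + p^2) = m2"
    using nz unfolding m2_def e y_def[symmetric]
    by (simp add: field_simps power2_eq_square)
  have M3: "x^3 * (x - 1)^3 * (p'' + 3 * p * p' + p^3) = m3"
    using nz unfolding m3_def e y_def[symmetric]
    by (simp add: field_simps power2_eq_square power3_eq_cube)
  note ms = m1_def m2_def m3_def a_def b_def
  show ?th1
    using M1 unfolding ms q1_def r1_def by algebra
  show ?th2
    using M1 M2 unfolding ms q1_def q2_def r2_def by algebra
  \<comment> \<open>The cubic terms have denominators up to \<open>x^3 * (x - 1)^3\<close>, one
    factor \<open>x * (x - 1)\<close> more than the leading coefficient supplies. The extra factor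
    makes everything polynomial and is cancelled at the end; \<open>q1\<close> brings its own factor
    \<open>x * (x - 1)\<close>, which turns its term into a multiple of \<open>m2\<close>.\<close>
  have "x * (x - 1) * (q3 A0 A1 A2 A3 x + q2 A0 A1 A2 A3 x * p + q1 A0 A1 A2 A3 x * (p' + p^2)
      + x^2 * (x - 1)^2 * (p'' + 3 * p * p' + p^3))
    = x * (x - 1) * q3 A0 A1 A2 A3 x + q2 A0 A1 A2 A3 x * m1 + (2*A2 + 3) * (2*x - 1) * m2 + m3"
    unfolding M1[symmetric] M2[symmetric] M3[symmetric] q1_def by algebra
  also have "\<dots> = x * (x - 1) * r3 A0 A1 A2 A3 x"
    unfolding ms q2_def q3_def r3_def by (simp add: field_simps) algebra
  finally show ?th3
    using assms(1,2) by simp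
qed

theorem proposition6p5:
  fixes A0 A1 A2 A3 :: complex
    and S :: "complex set"
    and g h :: "complex \<Rightarrow> complex"
  assumes "open S"
    and "power_branch_on S 0 (A0 + A2) g"
    and "power_branch_on S 1 (A1 + A2) h"
  shows "op_eq_on S (R_op g h A0 A1 A2 A3)
           (diff_op3 (\<lambda>x. x^2 * (x - 1)^2) (r1 A0 A1 A2 A3) (r2 A0 A1 A2 A3) (r3 A0 A1 A2 A3))"
  unfolding op_eq_on_def
proof (intro allI impI ballI)
  fix u x assume u: "u holomorphic_on S" and x: "x \<in> S"
  note G = power_branch_on_props[OF assms(1,2)]
  note H = power_branch_on_props[OF assms(1,3)]
  define w where "w = (\<lambda>x. inverse (g x) * inverse (h x))"
  define p where "p x = - (A0 + A2) / x - (A1 + A2) / (x - 1)" for x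
  define p' where "p' x = (A0 + A2) / x^2 + (A1 + A2) / (x - 1)^2" for x
  define p'' where "p'' x = - 2 * (A0 + A2) / x^3 - 2 * (A1 + A2) / (x - 1)^3" for x
  have w: "(w has_field_derivative p y * w y) (at y)" if "y \<in> S" for y
    unfolding w_def
    by (rule DERIV_cong[OF DERIV_mult[OF G(3)[OF that] H(3)[OF that]]])
       (simp add: p_def algebra_simps add_divide_distrib diff_divide_distrib)
  have nz: "y \<noteq> 0" "y \<noteq> 1" if "y \<in> S" for y
    using G(1)[OF that] H(1)[OF that] by auto
  have p: "(p has_field_derivative p' y) (at y)" if "y \<in> S" for y
    unfolding p_def p'_def
    by (auto intro!: derivative_eq_intros simp: nz[OF that])
       (simp add: nz[OF that] divide_simps power2_eq_square, simp add: algebra_simps)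
  have p': "(p' has_field_derivative p'' y) (at y)" if "y \<in> S" for y
    unfolding p'_def p''_def
    by (auto intro!: derivative_eq_intros simp: nz[OF that])
       (simp add: nz[OF that] divide_simps eval_nat_numeral, simp add: algebra_simps)
  note D = higher_deriv_mult_log_deriv[OF assms(1) x u w p p']
  note C = conjugated_coefficients[OF G(1)[OF x] H(1)[OF x] p_def p'_def p''_def, of A3, symmetric]
  have "g x * h x * w x = 1"
    using G(2)[OF x] H(2)[OF x] by (simp add: w_def field_simps)
  moreover have "R_op g h A0 A1 A2 A3 u x = g x * h x *
      diff_op3 (\<lambda>x. x^2 * (x - 1)^2) (q1 A0 A1 A2 A3) (q2 A0 A1 A2 A3) (q3 A0 A1 A2 A3)
        (\<lambda>x. w x * u x) x"
    by (simp add: R_op_def Ad_def mult_op_def Q_op_def w_def)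
  moreover have "\<dots> = g x * h x * w x *
      diff_op3 (\<lambda>x. x^2 * (x - 1)^2) (r1 A0 A1 A2 A3) (r2 A0 A1 A2 A3) (r3 A0 A1 A2 A3) u x"
    \<comment> \<open>\<open>D\<close> pulls \<open>w\<close> out of the derivatives and
      \<open>C\<close> rewrites each \<open>r\<close> coefficient through the \<open>q\<close>
      coefficients and \<open>p\<close>; only a ring identity remains.\<close>
    by (simp only: diff_op3_def D C) (simp only: algebra_simps)
  ultimately show "R_op g h A0 A1 A2 A3 u x =
      diff_op3 (\<lambda>x. x^2 * (x - 1)^2) (r1 A0 A1 A2 A3) (r2 A0 A1 A2 A3) (r3 A0 A1 A2 A3) u x"
    by simp
qed

end
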